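(* Let $\varphi$ be a Finsler norm in $\mathbb{R}^d$ with $\varphi^*\in C^1(\mathbb{R}^d\setminus\{0\})$. Then the Euclidean norm $\|\cdot\|$ is a shielding norm for $\varphi$. Furthermore, if $\overline{F},\underline{F}:\mathbb{R}^d\times\mathcal{S}^d\to\mathbb{R}$ satisfy (1) $\overline{F}(p,X+Y)\ge\overline{F}(p,X)$ and $\underline{F}(p,X+Y)\ge\underline{F}(p,X)$ for all $p\in\mathbb{R}^d$, $X,Y\in\mathcal{S}^d$ with $Y\ge 0$, and (2) $\overline{F}$ is upper semicontinuous and $\underline{F}$ is lower semicontinuous on $\mathbb{R}^d\times\mathcal{S}^d$, then the pair $(\overline{F},\underline{F})$ is compatible with $\varphi$ if and only if $$\overline{F}\equiv\underline{F}\ \text{ in }\ (\mathbb{R}^d\setminus\{0\})\times\mathcal{S}^d\quad\text{and}\quad\overline{F}(0,0)=\underline{F}(0,0).$$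
   Context: $\mathcal{S}^d$ is the space of real symmetric $d\times d$ matrices with its usual order; $\langle\cdot,\cdot\rangle$ and $\|\cdot\|$ are the Euclidean inner product and norm. A Finsler norm is a function $\varphi:\mathbb{R}^d\to[0,\infty)$ with $\varphi(\lambda q)=\lambda\varphi(q)$ for $\lambda>0$, $\varphi(q_1+q_2)\le\varphi(q_1)+\varphi(q_2)$, and $\min_{q\neq0}\varphi(q)/\|q\|>0$ (symmetry is not required). The dual norm is $\varphi^*(p)=\max_{q\ne0}\langle p,q\rangle/\varphi(q)$, and $\partial\varphi^*(p)$ is the usual convex subdifferential of $\varphi^*$ at $p$. For $p\in\mathbb{R}^d$ let $\mathcal{T}(p,\varphi)=\{v\in\mathbb{R}^d:\langle v,q\rangle=0\ \text{for all}\ q\in\partial\varphi^*(p)\}$. For a linear subspace $V\subseteq\mathbb{R}^d$ let $\pi_V$ be the orthogonal projection onto $V$ and $\mathcal{S}_V=\{X\in\mathcal{S}^d:\pi_V X\pi_V=X\}$. Set $\mathcal{S}(p,\varphi)=\mathcal{S}_{\langle p\rangle\oplus\mathcal{T}(p,\varphi)}$, where $\langle p\rangle$ is the linear span of $p$. The pair $(\overline F,\underline F)$ is compatible with $\varphi$ if $\overline{F}(p,X)=\underline{F}(p,X)$ for all $p\in\mathbb{R}^d$ and $X\in\mathcal{S}(p,\varphi)$. A Finsler norm $\psi$ is a shielding norm for $\varphi$ if $\psi\in C^2(\mathbb{R}^d\setminus\{0\})$ and $D^2\psi(q)\in\mathcal{S}(D\psi(q),\varphi)$ for every $q\in\mathbb{R}^d\setminus\{0\}$.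 *)

theory Defs
  imports "HOL-Analysis.Analysis"
begin

subsection \<open>Symmetric matrices\<close>

definition sym_mats :: "(real^'n^'n) set" where
  "sym_mats = {X. transpose X = X}"

definition loewner_le :: "real^'n^'n \<Rightarrow> real^'n^'n \<Rightarrow> bool" where
  "loewner_le X Y \<longleftrightarrow> (\<forall>v. v \<bullet> (X *v v) \<le> v \<bullet> (Y *v v))"

definition orth_proj :: "(real^'n) set \<Rightarrow> real^'n \<Rightarrow> real^'n" where
  "orth_proj V x = (THE y. y \<in> V \<and> x - y \<in> orthogonal_comp V)"

definition sym_mats_on :: "(real^'n) set \<Rightarrow> (real^'n^'n) set" where
  "sym_mats_on V =
     {X \<in> sym_mats. matrix (orth_proj V) ** X ** matrix (orth_proj V) = X}"

subsection \<open>Continuous differentiability\<close>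

text \<open>These notions are meant for open sets \<open>U\<close>: all derivatives are full (two-sided)
  derivatives at the points of \<open>U\<close>. Where the derivative does not exist, \<open>grad\<close> and \<open>hessian\<close>
  are unspecified, so they carry meaning only together with differentiability.\<close>

definition grad :: "(real^'n \<Rightarrow> real) \<Rightarrow> real^'n \<Rightarrow> real^'n" where
  "grad f x = (THE D. GDERIV f x :> D)"

definition hessian :: "(real^'n \<Rightarrow> real) \<Rightarrow> real^'n \<Rightarrow> real^'n^'n" where
  "hessian f x = jacobian (grad f) (at x)"

definition C1_on :: "(real^'n) set \<Rightarrow> (real^'n \<Rightarrow> real) \<Rightarrow> bool" where
  "C1_on U f \<longleftrightarrow> (\<forall>x\<in>U. f differentiable (at x)) \<and> continuous_on U (grad f)"

definition C2_on :: "(real^'n) set \<Rightarrow> (real^'n \<Rightarrow> real) \<Rightarrow> bool" where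
  "C2_on U f \<longleftrightarrow> C1_on U f \<and> (\<forall>x\<in>U. grad f differentiable (at x)) \<and>
     continuous_on U (hessian f)"

subsection \<open>Semicontinuity relative to a set\<close>

definition upper_semicontinuous_on :: "'a::topological_space set \<Rightarrow> ('a \<Rightarrow> real) \<Rightarrow> bool" where
  "upper_semicontinuous_on S f \<longleftrightarrow>
     (\<forall>x\<in>S. \<forall>c>f x. \<forall>\<^sub>F y in at x within S. f y < c)"

definition lower_semicontinuous_on :: "'a::topological_space set \<Rightarrow> ('a \<Rightarrow> real) \<Rightarrow> bool" where
  "lower_semicontinuous_on S f \<longleftrightarrow>
     (\<forall>x\<in>S. \<forall>c<f x. \<forall>\<^sub>F y in at x within S. c < f y)"

subsection \<open>Finsler norms\<close>

text \<open>The last conjunct says that the minimum of \<open>\<phi> q / norm q\<close> over \<open>q \<noteq> 0\<close> is attained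
  and positive.\<close>

definition finsler_norm :: "(real^'n \<Rightarrow> real) \<Rightarrow> bool" where
  "finsler_norm \<phi> \<longleftrightarrow>
     (\<forall>q. 0 \<le> \<phi> q) \<and>
     (\<forall>c>0. \<forall>q. \<phi> (c *\<^sub>R q) = c * \<phi> q) \<and>
     (\<forall>q1 q2. \<phi> (q1 + q2) \<le> \<phi> q1 + \<phi> q2) \<and>
     (\<exists>q0. q0 \<noteq> 0 \<and> 0 < \<phi> q0 / norm q0 \<and> (\<forall>q. q \<noteq> 0 \<longrightarrow> \<phi> q0 / norm q0 \<le> \<phi> q / norm q))"

definition dual_norm :: "(real^'n \<Rightarrow> real) \<Rightarrow> real^'n \<Rightarrow> real" where
  "dual_norm \<phi> p = (SUP q\<in>-{0}. (p \<bullet> q) / \<phi> q)"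

text \<open>The supremum in the dual norm is a maximum.\<close>

lemma dual_norm_attained:
  fixes \<phi> :: "real^'n \<Rightarrow> real"
  assumes "finsler_norm \<phi>"
  shows "\<exists>q. q \<noteq> 0 \<and> dual_norm \<phi> p = (p \<bullet> q) / \<phi> q \<and>
    (\<forall>q'. q' \<noteq> 0 \<longrightarrow> (p \<bullet> q') / \<phi> q' \<le> (p \<bullet> q) / \<phi> q)"
proof -
  have hom: "\<phi> (c *\<^sub>R q) = c * \<phi> q" if "c > 0" for c q
    using assms that by (auto simp: finsler_norm_def)
  have sub: "\<phi> (q1 + q2) \<le> \<phi> q1 + \<phi> q2" for q1 q2
    using assms by (auto simp: finsler_norm_def)
  obtain q0 where q0: "0 < \<phi> q0 / norm q0"
    "\<And>q. q \<noteq> 0 \<Longrightarrow> \<phi> q0 / norm q0 \<le> \<phi> q / norm q"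
    using assms unfolding finsler_norm_def by blast
  have pos: "\<phi> q > 0" if "q \<noteq> 0" for q
  proof -
    have "0 < \<phi> q / norm q" using q0 that by (meson less_le_trans)
    then show ?thesis using that by (simp add: zero_less_divide_iff)
  qed
  have "convex_on UNIV \<phi>"
  proof (rule convex_onI)
    fix t :: real and x y :: "real^'n"
    assume t: "t > 0" "t < 1"
    have "\<phi> ((1 - t) *\<^sub>R x + t *\<^sub>R y) \<le> \<phi> ((1 - t) *\<^sub>R x) + \<phi> (t *\<^sub>R y)" by (rule sub)
    then show "\<phi> ((1 - t) *\<^sub>R x + t *\<^sub>R y) \<le> (1 - t) * \<phi> x + t * \<phi> y"
      using t by (simp add: hom)
  qed simp
  then have cont: "continuous_on UNIV \<phi>"
    by (intro convex_on_continuous) auto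
  have nz: "q \<noteq> 0" if "q \<in> sphere (0::real^'n) 1" for q
    using that by auto
  have "continuous_on (sphere 0 1) (\<lambda>q. (p \<bullet> q) / \<phi> q)"
  proof (intro continuous_intros)
    show "continuous_on (sphere 0 1) \<phi>"
      using cont continuous_on_subset by blast
    show "\<forall>q\<in>sphere 0 1. \<phi> q \<noteq> 0"
      using pos nz by (metis less_irrefl)
  qed
  then have "\<exists>q\<in>sphere 0 1. \<forall>r\<in>sphere 0 1. (p \<bullet> r) / \<phi> r \<le> (p \<bullet> q) / \<phi> q"
    by (intro continuous_attains_sup) simp_all
  then obtain q where q: "q \<in> sphere 0 1"
    "\<And>r. r \<in> sphere 0 1 \<Longrightarrow> (p \<bullet> r) / \<phi> r \<le> (p \<bullet> q) / \<phi> q"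
    by blast
  have mx: "(p \<bullet> r) / \<phi> r \<le> (p \<bullet> q) / \<phi> q" if "r \<noteq> 0" for r
  proof -
    have eq: "(p \<bullet> (inverse (norm r) *\<^sub>R r)) / \<phi> (inverse (norm r) *\<^sub>R r) = (p \<bullet> r) / \<phi> r"
      using that by (simp add: hom)
    have "inverse (norm r) *\<^sub>R r \<in> sphere 0 1"
      using that by simp
    from q(2)[OF this] show ?thesis unfolding eq .
  qed
  have "dual_norm \<phi> p = (p \<bullet> q) / \<phi> q"
    unfolding dual_norm_def using mx nz[OF q(1)] by (intro cSup_eq_maximum) auto
  then show ?thesis using mx nz[OF q(1)] by blast
qed

definition subdiff :: "(real^'n \<Rightarrow> real) \<Rightarrow> real^'n \<Rightarrow> (real^'n) set" where
  "subdiff f p = {q. \<forall>x. f p + q \<bullet> (x - p) \<le> f x}"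

definition T_space :: "real^'n \<Rightarrow> (real^'n \<Rightarrow> real) \<Rightarrow> (real^'n) set" where
  "T_space p \<phi> = {v. \<forall>q \<in> subdiff (dual_norm \<phi>) p. v \<bullet> q = 0}"

text \<open>The sum of subspaces below is direct for every Finsler norm \<open>\<phi>\<close>, since
  \<open>p \<bullet> q = dual_norm \<phi> p > 0\<close> for \<open>p \<noteq> 0\<close> and \<open>q \<in> subdiff (dual_norm \<phi>) p\<close>.\<close>

definition S_space :: "real^'n \<Rightarrow> (real^'n \<Rightarrow> real) \<Rightarrow> (real^'n^'n) set" where
  "S_space p \<phi> = sym_mats_on (span {p} + T_space p \<phi>)"

definition compatible ::
  "((real^'n) \<times> (real^'n^'n) \<Rightarrow> real) \<Rightarrow> ((real^'n) \<times> (real^'n^'n) \<Rightarrow> real) \<Rightarrow>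
    (real^'n \<Rightarrow> real) \<Rightarrow> bool" where
  "compatible Fup Flow \<phi> \<longleftrightarrow> (\<forall>p. \<forall>X \<in> S_space p \<phi>. Fup (p, X) = Flow (p, X))"

definition shielding_norm :: "(real^'n \<Rightarrow> real) \<Rightarrow> (real^'n \<Rightarrow> real) \<Rightarrow> bool" where
  "shielding_norm \<psi> \<phi> \<longleftrightarrow>
     finsler_norm \<psi> \<and> C2_on (-{0}) \<psi> \<and>
     (\<forall>q. q \<noteq> 0 \<longrightarrow> hessian \<psi> q \<in> S_space (grad \<psi> q) \<phi>)"

text \<open>Functions on \<open>(real^'n) \<times> sym_mats\<close> are represented by functions on all
  pairs; their values at non-symmetric matrices are never constrained or used.\<close>

definition degenerate_elliptic :: "((real^'n) \<times> (real^'n^'n) \<Rightarrow> real) \<Rightarrow> bool" where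
  "degenerate_elliptic F \<longleftrightarrow>
     (\<forall>p. \<forall>X\<in>sym_mats. \<forall>Y\<in>sym_mats. loewner_le 0 Y \<longrightarrow> F (p, X + Y) \<ge> F (p, X))"

end

theory Submission
  imports Defs
begin

text \<open>
  Smoothness of the dual norm trivialises the spaces \<open>S_space p \<phi>\<close>. At \<open>p \<noteq> 0\<close> the
  subdifferential of a differentiable function has at most one element, the gradient \<open>g\<close>, so
  \<open>T_space p \<phi>\<close> contains the hyperplane orthogonal to \<open>g\<close>. Euler's identity for the positively
  homogeneous dual norm gives \<open>p \<bullet> g = dual_norm \<phi> p > 0\<close>, hence \<open>p\<close> is transversal to that
  hyperplane and the two together span everything: \<open>S_space p \<phi>\<close> consists of all symmetric
  matrices (\<open>S_space_nonzero\<close>). At \<open>p = 0\<close> the subdifferential contains a positive multiple of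
  every vector \<open>v \<noteq> 0\<close>, so \<open>T_space 0 \<phi>\<close> is trivial and \<open>S_space 0 \<phi> = {0}\<close>
  (\<open>S_space_zero\<close>).

  With these two descriptions, compatibility unfolds literally to the stated condition, and the
  shielding property of the Euclidean norm reduces to its being twice continuously
  differentiable off the origin with a symmetric Hessian and a nowhere vanishing gradient.
\<close>

section \<open>Matrices supported on extreme subspaces\<close>

lemma zero_in_sym_mats: "0 \<in> sym_mats"
  by (simp add: sym_mats_def transpose_def vec_eq_iff)

lemma sym_mats_on_UNIV: "sym_mats_on (UNIV :: (real^'n) set) = sym_mats"
proof -
  have "orth_proj (UNIV :: (real^'n) set) = id"
    by (auto simp: orth_proj_def orthogonal_comp_UNIV fun_eq_iff)
  then show ?thesis
    by (simp add: sym_mats_on_def matrix_id_mat_1)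
qed

lemma sym_mats_on_trivial: "sym_mats_on {0 :: real^'n} = {0}"
proof -
  have "orth_proj {0 :: real^'n} = (\<lambda>x. 0)"
    by (auto simp: orth_proj_def orthogonal_comp_null fun_eq_iff)
  moreover have "matrix (\<lambda>x :: real^'n. 0 :: real^'n) = 0"
    by (simp add: matrix_def vec_eq_iff)
  ultimately show ?thesis
    using zero_in_sym_mats
    by (auto simp: sym_mats_on_def)
qed

section \<open>The dual norm and its subdifferential\<close>

lemma finsler_norm_pos:
  assumes "finsler_norm \<phi>" and "q \<noteq> 0"
  shows "\<phi> q > 0"
proof -
  obtain q0 where "0 < \<phi> q0 / norm q0" "\<phi> q0 / norm q0 \<le> \<phi> q / norm q"
    using assms unfolding finsler_norm_def by blast
  then have "0 < \<phi> q / norm q"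
    by linarith
  then show ?thesis
    using assms(2) by (simp add: zero_less_divide_iff)
qed

lemma dual_norm_upper:
  assumes "finsler_norm \<phi>" and "q \<noteq> 0"
  shows "(p \<bullet> q) / \<phi> q \<le> dual_norm \<phi> p"
  using dual_norm_attained[OF assms(1), of p] assms(2) by metis

lemma dual_norm_pos:
  assumes "finsler_norm \<phi>" and "p \<noteq> 0"
  shows "dual_norm \<phi> p > 0"
proof -
  have "0 < (p \<bullet> p) / \<phi> p"
    using assms(2) finsler_norm_pos[OF assms] by simp
  then show ?thesis
    using dual_norm_upper[OF assms, of p] by linarith
qed

lemma dual_norm_zero:
  assumes "finsler_norm \<phi>"
  shows "dual_norm \<phi> 0 = 0"
  using dual_norm_attained[OF assms, of 0] by auto

lemma dual_norm_scaleR: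
  assumes "finsler_norm \<phi>" and "t > 0"
  shows "dual_norm \<phi> (t *\<^sub>R p) = t * dual_norm \<phi> p"
proof (rule antisym)
  obtain q where "q \<noteq> 0" "dual_norm \<phi> (t *\<^sub>R p) = (t *\<^sub>R p \<bullet> q) / \<phi> q"
    using dual_norm_attained[OF assms(1)] by blast
  then show "dual_norm \<phi> (t *\<^sub>R p) \<le> t * dual_norm \<phi> p"
    using mult_left_mono[OF dual_norm_upper[OF assms(1), of q p], of t] assms(2) by simp
next
  obtain q where "q \<noteq> 0" "dual_norm \<phi> p = (p \<bullet> q) / \<phi> q"
    using dual_norm_attained[OF assms(1)] by blast
  then show "t * dual_norm \<phi> p \<le> dual_norm \<phi> (t *\<^sub>R p)"
    using dual_norm_upper[OF assms(1), of q "t *\<^sub>R p"] by simp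
qed

text \<open>A subgradient \<open>q\<close> makes \<open>p\<close> a global minimiser of \<open>x \<mapsto> f x - q \<bullet> x\<close>, so the derivative of
  this function vanishes at \<open>p\<close>.\<close>

lemma subdiff_eq_derivative:
  assumes "(f has_derivative f') (at p)" and "q \<in> subdiff f p"
  shows "f' h = q \<bullet> h"
proof -
  have "((\<lambda>x. f x - q \<bullet> x) has_derivative (\<lambda>h. f' h - q \<bullet> h)) (at p)"
    by (intro derivative_intros assms(1))
  moreover have "f p - q \<bullet> p \<le> f y - q \<bullet> y" for y
    using assms(2) by (simp add: subdiff_def inner_diff_right algebra_simps)
  ultimately have "(\<lambda>h. f' h - q \<bullet> h) = (\<lambda>h. 0)"
    using differential_zero_maxmin[of p UNIV "\<lambda>x. f x - q \<bullet> x"] by auto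
  then show ?thesis
    by (auto simp: fun_eq_iff)
qed

text \<open>Euler's identity, in the direction of the ray through \<open>p\<close>.\<close>

lemma homogeneous_derivative_self:
  fixes f :: "'a::real_normed_vector \<Rightarrow> real"
  assumes "(f has_derivative f') (at p)" and hom: "\<And>t. t > 0 \<Longrightarrow> f (t *\<^sub>R p) = t * f p"
  shows "f' p = f p"
proof -
  have "((\<lambda>t. f (t *\<^sub>R p)) has_derivative (\<lambda>s. f' (s *\<^sub>R p))) (at 1)"
  proof (rule has_derivative_compose[where g = f])
    show "((\<lambda>t. t *\<^sub>R p) has_derivative (\<lambda>s. s *\<^sub>R p)) (at 1)"
      by (intro derivative_eq_intros) auto
    show "(f has_derivative f') (at (1 *\<^sub>R p))"
      using assms(1) by simp
  qed
  moreover have "((\<lambda>t. f (t *\<^sub>R p)) has_derivative (\<lambda>s. s * f p)) (at 1)"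
  proof (rule has_derivative_transform_within_open[where s = "{0<..}"])
    show "((\<lambda>t. t * f p) has_derivative (\<lambda>s. s * f p)) (at 1)"
      by (intro derivative_eq_intros) auto
  qed (auto simp: hom)
  ultimately have "(\<lambda>s. f' (s *\<^sub>R p)) = (\<lambda>s. s * f p)"
    by (rule has_derivative_unique)
  from fun_cong[OF this, of 1] show ?thesis
    by simp
qed

section \<open>The spaces of admissible matrices\<close>

lemma S_space_nonzero:
  assumes "finsler_norm \<phi>" and diff: "dual_norm \<phi> differentiable (at p)" and "p \<noteq> 0"
  shows "S_space p \<phi> = sym_mats"
proof -
  obtain f' where f': "(dual_norm \<phi> has_derivative f') (at p)"
    using diff by (auto simp: differentiable_def)
  have lin: "linear f'"
    using f' has_derivative_linear by blast
  have "f' p = dual_norm \<phi> p"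
    by (rule homogeneous_derivative_self[OF f']) (rule dual_norm_scaleR[OF assms(1)])
  then have pos: "f' p > 0"
    using dual_norm_pos[OF assms(1,3)] by simp
  have "v \<in> span {p} + T_space p \<phi>" for v
  proof -
    \<comment> \<open>The splitting of \<open>v\<close> along \<open>p\<close> and the kernel of the derivative.\<close>
    define c where "c = f' v / f' p"
    have "f' (v - c *\<^sub>R p) = 0"
      using pos by (simp add: c_def linear_diff[OF lin] linear_scale[OF lin])
    then have "v - c *\<^sub>R p \<in> T_space p \<phi>"
      using subdiff_eq_derivative[OF f'] by (auto simp: T_space_def inner_commute)
    moreover have "c *\<^sub>R p \<in> span {p}"
      by (simp add: span_base span_scale)
    ultimately have "c *\<^sub>R p + (v - c *\<^sub>R p) \<in> span {p} + T_space p \<phi>"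
      by (rule set_plus_intro[rotated])
    then show ?thesis
      by simp
  qed
  then have "span {p} + T_space p \<phi> = UNIV"
    by blast
  then show ?thesis
    by (simp add: S_space_def sym_mats_on_UNIV)
qed

lemma S_space_zero:
  assumes "finsler_norm \<phi>"
  shows "S_space 0 \<phi> = {0}"
proof -
  have "v = 0" if v: "v \<in> T_space 0 \<phi>" for v
  proof (rule ccontr)
    assume nz: "v \<noteq> 0"
    \<comment> \<open>The subdifferential of the dual norm at the origin is the unit ball of \<open>\<phi>\<close>.\<close>
    have "v /\<^sub>R \<phi> v \<in> subdiff (dual_norm \<phi>) 0"
      using dual_norm_upper[OF assms nz] dual_norm_zero[OF assms]
      by (simp add: subdiff_def inner_commute divide_inverse mult.commute)
    then have "v \<bullet> (v /\<^sub>R \<phi> v) = 0"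
      using v unfolding T_space_def by blast
    then show False
      using nz finsler_norm_pos[OF assms nz] by simp
  qed
  moreover have "0 \<in> T_space 0 \<phi>"
    by (simp add: T_space_def)
  ultimately have "T_space 0 \<phi> = {0}"
    by blast
  then have "span {0} + T_space 0 \<phi> = {0}"
    by (simp add: set_plus_def)
  then show ?thesis
    by (simp add: S_space_def sym_mats_on_trivial)
qed

section \<open>Second-order calculus of the Euclidean norm\<close>

lemma finsler_norm_norm: "finsler_norm (norm :: real^'n \<Rightarrow> real)"
proof -
  have "axis undefined 1 \<noteq> (0 :: real^'n)"
    by (simp add: axis_eq_0_iff)
  then show ?thesis
    by (auto simp: finsler_norm_def norm_triangle_ineq intro!: exI[of _ "axis undefined 1"])
qed

lemma grad_eq:
  assumes "GDERIV f x :> D"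
  shows "grad f x = D"
  unfolding grad_def using assms
proof (rule the_equality)
  fix E assume "GDERIV f x :> E"
  then have "(\<lambda>h. h \<bullet> E) = (\<lambda>h. h \<bullet> D)"
    using assms unfolding gderiv_def by (rule has_derivative_unique)
  from fun_cong[OF this, of "E - D"] have "(E - D) \<bullet> (E - D) = 0"
    by (simp add: inner_diff_right)
  then show "E = D"
    by simp
qed

lemma grad_norm:
  assumes "x \<noteq> (0 :: real^'n)"
  shows "grad norm x = sgn x"
  by (rule grad_eq) (rule GDERIV_norm[OF assms])

text \<open>Geometrically, the derivative scales by \<open>1 / norm x\<close> the component of \<open>h\<close> orthogonal to \<open>x\<close>:
  the direction of \<open>x\<close> does not change along the ray through \<open>x\<close>.\<close>

lemma has_derivative_sgn:
  assumes "x \<noteq> (0 :: 'a::real_inner)"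
  shows "(sgn has_derivative (\<lambda>h. h /\<^sub>R norm x - ((x \<bullet> h) / norm x ^ 3) *\<^sub>R x)) (at x)"
proof -
  have "(norm has_derivative (\<lambda>h. h \<bullet> sgn x)) (at x)"
    using GDERIV_norm[OF assms] by (simp add: gderiv_def)
  then have "((\<lambda>y. inverse (norm y) *\<^sub>R y) has_derivative
          (\<lambda>h. h /\<^sub>R norm x - ((x \<bullet> h) / norm x ^ 3) *\<^sub>R x)) (at x)"
    using assms
    by (auto intro!: derivative_eq_intros
        simp: fun_eq_iff sgn_div_norm inner_commute divide_inverse power3_eq_cube)
  then show ?thesis
    by (simp add: sgn_div_norm[abs_def])
qed

lemma has_derivative_grad_norm:
  assumes "x \<noteq> (0 :: real^'n)"
  shows "(grad norm has_derivative (\<lambda>h. h /\<^sub>R norm x - ((x \<bullet> h) / norm x ^ 3) *\<^sub>R x)) (at x)"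
  by (rule has_derivative_transform_within_open[OF has_derivative_sgn, where s = "-{0}"])
    (auto simp: assms grad_norm)

lemma hessian_norm:
  assumes "x \<noteq> (0 :: real^'n)"
  shows "hessian norm x =
    (\<chi> i j. (if i = j then 1 else 0) / norm x - x $ i * x $ j / norm x ^ 3)"
  unfolding hessian_def jacobian_def
    frechet_derivative_at[OF has_derivative_grad_norm[OF assms], symmetric]
  by (simp add: matrix_def vec_eq_iff axis_def inner_axis inner_vec_def divide_inverse
      if_distrib if_distribR cong: if_cong)

lemma C2_on_norm: "C2_on (-{0}) (norm :: real^'n \<Rightarrow> real)"
  unfolding C2_on_def C1_on_def
proof (intro conjI ballI)
  fix x :: "real^'n" assume x: "x \<in> -{0}"
  show "norm differentiable (at x)"
    using GDERIV_norm[of x] x by (auto simp: gderiv_def differentiable_def)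
  show "grad norm differentiable (at x)"
    using has_derivative_grad_norm[of x] x by (auto simp: differentiable_def)
next
  have "continuous_on (-{0}) (sgn :: real^'n \<Rightarrow> real^'n)"
    by (intro continuous_intros) auto
  then show "continuous_on (-{0}) (grad (norm :: real^'n \<Rightarrow> real))"
    by (rule continuous_on_eq) (simp add: grad_norm)
next
  have "continuous_on (-{0}) (\<lambda>x :: real^'n. \<chi> i j.
      (if i = j then 1 else 0) / norm x - x $ i * x $ j / norm x ^ 3)"
    by (intro continuous_on_vec_lambda continuous_intros) auto
  then show "continuous_on (-{0}) (hessian (norm :: real^'n \<Rightarrow> real))"
    by (rule continuous_on_eq) (simp add: hessian_norm)
qed

section \<open>Shielding and compatibility\<close>

theorem proposition1:
  fixes \<phi> :: "real^'n \<Rightarrow> real"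
  assumes "finsler_norm \<phi>"
    and "C1_on (-{0}) (dual_norm \<phi>)"
  shows "shielding_norm norm \<phi> \<and>
    (\<forall>Fup Flow :: (real^'n) \<times> (real^'n^'n) \<Rightarrow> real.
       degenerate_elliptic Fup \<longrightarrow> degenerate_elliptic Flow \<longrightarrow>
       upper_semicontinuous_on (UNIV \<times> sym_mats) Fup \<longrightarrow>
       lower_semicontinuous_on (UNIV \<times> sym_mats) Flow \<longrightarrow>
       (compatible Fup Flow \<phi> \<longleftrightarrow>
          (\<forall>p X. p \<noteq> 0 \<longrightarrow> X \<in> sym_mats \<longrightarrow> Fup (p, X) = Flow (p, X)) \<and>
          Fup (0, 0) = Flow (0, 0)))"
proof -
  have S: "S_space p \<phi> = (if p = 0 then {0} else sym_mats)" for p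
    using S_space_zero[OF assms(1)] S_space_nonzero[OF assms(1), of p] assms(2)
    by (auto simp: C1_on_def)
  have "hessian norm q \<in> S_space (grad norm q) \<phi>" if q: "q \<noteq> 0" for q
  proof -
    have "hessian norm q \<in> sym_mats"
      by (simp add: hessian_norm[OF q] sym_mats_def transpose_def vec_eq_iff mult.commute)
    moreover have "grad norm q \<noteq> 0"
      using q by (simp add: grad_norm sgn_zero_iff)
    ultimately show ?thesis
      by (simp add: S)
  qed
  then have "shielding_norm norm \<phi>"
    by (simp add: shielding_norm_def finsler_norm_norm C2_on_norm)
  moreover have "compatible Fup Flow \<phi> \<longleftrightarrow>
      (\<forall>p X. p \<noteq> 0 \<longrightarrow> X \<in> sym_mats \<longrightarrow> Fup (p, X) = Flow (p, X)) \<and>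
      Fup (0, 0) = Flow (0, 0)" for Fup Flow :: "(real^'n) \<times> (real^'n^'n) \<Rightarrow> real"
    by (auto simp: compatible_def S)
  ultimately show ?thesis
    by blast
qed

end
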